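(* Let $n\ge1$, let $\theta=(w,b)\in\mathbb{R}^{n\times n}\times\mathbb{R}^n$, let $v\in\mathbb{R}^{n\times n}\times\mathbb{R}^n$ be a direction with entries $v_{i,j}$ and $v_i$, and let $x^0\in\{0,1\}^n$ be such that $c_{\theta,v}(x^0)\neq0$, where $$c_{\theta,v}(x^0)=\sum_{i=1}^n|v_i|\,\sigma(u_i(x^0,\theta))+\sum_{i=1}^n\sum_{j=1}^n|v_{i,j}|\,x_j^0\,\sigma(u_i(x^0,\theta)).$$ Define, for $x^1\in\{0,1\}^n$, $$P^+_{\theta,v}(x^0,x^1)=\frac{P_\theta(x^0,x^1)}{c_{\theta,v}(x^0)}\sum_{i=1}^n\left[x_i^1\Big((v_i)_++\sum_{j=1}^n(v_{i,j})_+x_j^0\Big)+\sigma(u_i(x^0,\theta))\Big((v_i)_-+\sum_{j=1}^n(v_{i,j})_-x_j^0\Big)\right],$$ $$P^-_{\theta,v}(x^0,x^1)=\frac{P_\theta(x^0,x^1)}{c_{\theta,v}(x^0)}\sum_{i=1}^n\left[x_i^1\Big((v_i)_-+\sum_{j=1}^n(v_{i,j})_-x_j^0\Big)+\sigma(u_i(x^0,\theta))\Big((v_i)_++\sum_{j=1}^n(v_{i,j})_+x_j^0\Big)\right].$$ Then $P^+_{\theta,v}(x^0,\cdot)$ and $P^-_{\theta,v}(x^0,\cdot)$ are probability measures on $\{0,1\}^n$, and for every $e:\{0,1\}^n\to\mathbb{R}$, $$\nabla_\theta\left[\sum_{x^1}e(x^1)P_\theta(x^0,x^1)\right]v=c_{\theta,v}(x^0)\left[\sum_{x^1}e(x^1)P^+_{\theta,v}(x^0,x^1)-\sum_{x^1}e(x^1)P^-_{\theta,v}(x^0,x^1)\right],$$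 where the sums are over $x^1\in\{0,1\}^n$ and the left side is the directional derivative at $\theta$ in the direction $v$ (the inner product of the gradient in $\theta$ with $v$).
   Context: $\sigma(s)=1/(1+e^{-s})$; $\gamma_+=\max\{0,\gamma\}$, $\gamma_-=\max\{0,-\gamma\}$ for real $\gamma$. For $\theta=(w,b)$ and $x\in\{0,1\}^n$ let $u_i(x,\theta)=\sum_{j=1}^n w_{i,j}x_j+b_i$. The Markov kernel of the Little model on $\{0,1\}^n$ is $$P_\theta(x^0,x^1)=\prod_{i=1}^n\sigma(u_i(x^0,\theta))^{x_i^1}\,(1-\sigma(u_i(x^0,\theta)))^{1-x_i^1}.$$ The entry $v_{i,j}$ of $v$ is the perturbation of the weight $w_{i,j}$ and the entry $v_i$ is the perturbation of the bias $b_i$. *)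

theory Defs
  imports "HOL-Probability.Probability"
begin

text \<open>A state in \<open>{0,1}\<^sup>n\<close> is a vector of type \<open>bool ^ 'n\<close>, with \<open>n = CARD('n)\<close> (so \<open>n \<ge> 1\<close>);
  its entries enter formulas as numbers through \<^const>\<open>of_bool\<close>.
  Parameters and directions are pairs of a weight matrix and a bias vector; with the product
  inner product this is the Euclidean space of dimension \<open>n\<^sup>2 + n\<close>.\<close>

type_synonym 'n state = "bool ^ 'n"
type_synonym 'n param = "(real ^ 'n ^ 'n) \<times> (real ^ 'n)"

definition sigmoid :: "real \<Rightarrow> real" where
  "sigmoid s = 1 / (1 + exp (- s))"

definition pos_part :: "real \<Rightarrow> real" where
  "pos_part \<gamma> = max 0 \<gamma>"

definition neg_part :: "real \<Rightarrow> real" where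
  "neg_part \<gamma> = max 0 (- \<gamma>)"

definition weight :: "'n::finite param \<Rightarrow> 'n \<Rightarrow> 'n \<Rightarrow> real" where
  "weight \<theta> i j = fst \<theta> $ i $ j"

definition bias :: "'n::finite param \<Rightarrow> 'n \<Rightarrow> real" where
  "bias \<theta> i = snd \<theta> $ i"

definition local_field :: "'n::finite state \<Rightarrow> 'n param \<Rightarrow> 'n \<Rightarrow> real" where
  "local_field x \<theta> i = (\<Sum>j\<in>UNIV. weight \<theta> i j * of_bool (x $ j)) + bias \<theta> i"

definition little_kernel :: "'n::finite param \<Rightarrow> 'n state \<Rightarrow> 'n state \<Rightarrow> real" where
  "little_kernel \<theta> x0 x1 =
     (\<Prod>i\<in>UNIV. sigmoid (local_field x0 \<theta> i) ^ of_bool (x1 $ i)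
              * (1 - sigmoid (local_field x0 \<theta> i)) ^ (1 - of_bool (x1 $ i)))"

definition c_const :: "'n::finite param \<Rightarrow> 'n param \<Rightarrow> 'n state \<Rightarrow> real" where
  "c_const \<theta> v x0 =
     (\<Sum>i\<in>UNIV. \<bar>bias v i\<bar> * sigmoid (local_field x0 \<theta> i))
     + (\<Sum>i\<in>UNIV. \<Sum>j\<in>UNIV. \<bar>weight v i j\<bar> * of_bool (x0 $ j) * sigmoid (local_field x0 \<theta> i))"

definition P_plus :: "'n::finite param \<Rightarrow> 'n param \<Rightarrow> 'n state \<Rightarrow> 'n state \<Rightarrow> real" where
  "P_plus \<theta> v x0 x1 =
     little_kernel \<theta> x0 x1 / c_const \<theta> v x0 *
     (\<Sum>i\<in>UNIV.
        of_bool (x1 $ i)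
          * (pos_part (bias v i) + (\<Sum>j\<in>UNIV. pos_part (weight v i j) * of_bool (x0 $ j)))
        + sigmoid (local_field x0 \<theta> i)
          * (neg_part (bias v i) + (\<Sum>j\<in>UNIV. neg_part (weight v i j) * of_bool (x0 $ j))))"

definition P_minus :: "'n::finite param \<Rightarrow> 'n param \<Rightarrow> 'n state \<Rightarrow> 'n state \<Rightarrow> real" where
  "P_minus \<theta> v x0 x1 =
     little_kernel \<theta> x0 x1 / c_const \<theta> v x0 *
     (\<Sum>i\<in>UNIV.
        of_bool (x1 $ i)
          * (neg_part (bias v i) + (\<Sum>j\<in>UNIV. neg_part (weight v i j) * of_bool (x0 $ j)))
        + sigmoid (local_field x0 \<theta> i)
          * (pos_part (bias v i) + (\<Sum>j\<in>UNIV. pos_part (weight v i j) * of_bool (x0 $ j))))"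

end

theory Submission
  imports Defs
begin

text \<open>Given the initial state, the next state consists of independent Bernoulli variables with
  means \<open>s\<^sub>i = \<sigma>(u\<^sub>i)\<close>.  Since \<open>\<sigma>' = \<sigma> (1 - \<sigma>)\<close>, each factor \<open>f\<close> of the kernel satisfies
  \<open>\<partial>f/\<partial>u\<^sub>i = (x\<^sub>i - s\<^sub>i) f\<close>; as \<open>u\<^sub>i\<close> is linear in the parameters, the product rule gives the
  derivative of the kernel in direction \<open>v\<close> as \<open>P(x) \<Sum>\<^sub>i (x\<^sub>i - s\<^sub>i) u\<^sub>i(v)\<close>
  (lemma \<open>has_derivative_little_kernel\<close>).

  Writing \<open>u\<^sub>i(v) = A\<^sub>i - B\<^sub>i\<close>, where \<open>A\<^sub>i\<close> and \<open>B\<^sub>i\<close> collect the positive and negative parts of the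
  entries of \<open>v\<close>, each summand splits as
  \<open>(x\<^sub>i A\<^sub>i + s\<^sub>i B\<^sub>i) - (x\<^sub>i B\<^sub>i + s\<^sub>i A\<^sub>i)\<close>.  Both brackets are nonnegative, and because \<open>x\<^sub>i\<close> has
  mean \<open>s\<^sub>i\<close>, both have the same mean \<open>s\<^sub>i (A\<^sub>i + B\<^sub>i)\<close> under the kernel.  The sum of these means is
  \<open>c\<close>, so normalizing by \<open>c\<close> yields two probability measures (lemma \<open>tilted_kernel_pmf\<close>), and
  their difference is the derivative of the kernel divided by \<open>c\<close>.\<close>

lemma sigmoid_pos: "0 < sigmoid s"
  and sigmoid_less_1: "sigmoid s < 1"
  by (simp_all add: sigmoid_def add_pos_pos)

lemma has_real_derivative_sigmoid:
  "(sigmoid has_real_derivative sigmoid s * (1 - sigmoid s)) (at s)"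
proof -
  have "1 + exp (- s) > 0" by (simp add: add_pos_pos)
  then show ?thesis
    unfolding sigmoid_def[abs_def]
    by (auto intro!: derivative_eq_intros simp: field_simps power2_eq_square)
qed

lemma little_kernel_eq_prod_if:
  "little_kernel \<theta> x0 x1 =
     (\<Prod>i\<in>UNIV. if x1 $ i then sigmoid (local_field x0 \<theta> i) else 1 - sigmoid (local_field x0 \<theta> i))"
  unfolding little_kernel_def by (intro prod.cong) auto

lemma little_kernel_nonneg: "0 \<le> little_kernel \<theta> x0 x1"
  unfolding little_kernel_eq_prod_if
  by (intro prod_nonneg) (auto simp: sigmoid_pos sigmoid_less_1 less_imp_le)

lemma sum_state_prod:
  fixes f :: "'n::finite \<Rightarrow> bool \<Rightarrow> real"
  shows "(\<Sum>x\<in>(UNIV :: 'n state set). \<Prod>i\<in>UNIV. f i (x $ i)) = (\<Prod>i\<in>UNIV. f i True + f i False)"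
proof -
  have "bij_betw vec_nth (UNIV :: 'n state set) (UNIV :: ('n \<Rightarrow> bool) set)"
    by (rule bij_betw_byWitness[where f' = vec_lambda]) auto
  then have "(\<Sum>x\<in>(UNIV :: 'n state set). \<Prod>i\<in>UNIV. f i (x $ i)) =
      (\<Sum>g\<in>(UNIV :: ('n \<Rightarrow> bool) set). \<Prod>i\<in>UNIV. f i (g i))"
    by (rule sum.reindex_bij_betw)
  also have "\<dots> = (\<Prod>i\<in>UNIV. \<Sum>b\<in>UNIV. f i b)"
    by (subst prod_sum_PiE) (auto simp: PiE_UNIV_domain)
  finally show ?thesis by (simp add: UNIV_bool add.commute)
qed

lemma sum_little_kernel:
  fixes \<theta> :: "'n::finite param"
  shows "(\<Sum>x1\<in>UNIV. little_kernel \<theta> x0 x1) = 1"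
  unfolding little_kernel_eq_prod_if
  by (subst sum_state_prod[where f = "\<lambda>i b. if b then sigmoid (local_field x0 \<theta> i)
        else 1 - sigmoid (local_field x0 \<theta> i)"]) simp

text \<open>The coordinate \<open>x\<^sub>k\<close> only modifies the factor of index \<open>k\<close>, so the sum still factorizes.\<close>
lemma mean_little_kernel:
  fixes \<theta> :: "'n::finite param"
  shows "(\<Sum>x1\<in>UNIV. little_kernel \<theta> x0 x1 * of_bool (x1 $ k)) = sigmoid (local_field x0 \<theta> k)"
proof -
  define s where "s i = sigmoid (local_field x0 \<theta> i)" for i
  define f where "f i b = (if b then s i else 1 - s i) * (if i = k then of_bool b else 1)" for i b
  have "little_kernel \<theta> x0 x1 * of_bool (x1 $ k) = (\<Prod>i\<in>UNIV. f i (x1 $ i))" for x1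
    unfolding f_def prod.distrib s_def little_kernel_eq_prod_if by simp
  then have "(\<Sum>x1\<in>UNIV. little_kernel \<theta> x0 x1 * of_bool (x1 $ k)) =
      (\<Prod>i\<in>UNIV. f i True + f i False)"
    by (simp add: sum_state_prod)
  also have "\<dots> = (\<Prod>i\<in>UNIV. if i = k then s i else 1)"
    by (intro prod.cong) (auto simp: f_def)
  finally show ?thesis by (simp add: s_def)
qed

text \<open>Under the kernel \<open>x\<^sub>i\<close> has mean \<open>s\<^sub>i\<close>, so both terms of each summand contribute with weight
  \<open>s\<^sub>i\<close> to the total mass.  The normalization \<open>c\<close> is therefore symmetric in \<open>A\<close> and \<open>B\<close>, and
  exchanging them turns one of the two measures into the other.\<close>
lemma tilted_kernel_pmf:
  fixes \<theta> :: "'n::finite param" and x0 :: "'n state" and A B :: "'n \<Rightarrow> real"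
  defines "s \<equiv> \<lambda>i. sigmoid (local_field x0 \<theta> i)"
  assumes A: "\<And>i. 0 \<le> A i" and B: "\<And>i. 0 \<le> B i"
    and c: "c = (\<Sum>i\<in>UNIV. s i * (A i + B i))" "c \<noteq> 0"
  shows "\<exists>p :: 'n state pmf. \<forall>x1. pmf p x1 =
    little_kernel \<theta> x0 x1 / c * (\<Sum>i\<in>UNIV. of_bool (x1 $ i) * A i + s i * B i)"
proof -
  define h where "h x1 = little_kernel \<theta> x0 x1 / c *
    (\<Sum>i\<in>UNIV. of_bool (x1 $ i) * A i + s i * B i)" for x1
  have s: "0 \<le> s i" for i by (simp add: s_def sigmoid_pos less_imp_le)
  have "0 \<le> c" unfolding c by (intro sum_nonneg mult_nonneg_nonneg add_nonneg_nonneg s A B)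
  then have nonneg: "0 \<le> h x1" for x1
    unfolding h_def
    by (intro mult_nonneg_nonneg divide_nonneg_nonneg little_kernel_nonneg sum_nonneg
        add_nonneg_nonneg s A B) auto
  have "(\<Sum>x1\<in>UNIV. h x1) = (\<Sum>x1\<in>UNIV. \<Sum>i\<in>UNIV.
      (little_kernel \<theta> x0 x1 * of_bool (x1 $ i)) * A i / c + little_kernel \<theta> x0 x1 * (s i * B i) / c)"
    by (simp add: h_def sum_distrib_left distrib_left mult_ac)
  also have "\<dots> = (\<Sum>i\<in>UNIV. \<Sum>x1\<in>UNIV.
      (little_kernel \<theta> x0 x1 * of_bool (x1 $ i)) * A i / c + little_kernel \<theta> x0 x1 * (s i * B i) / c)"
    by (rule sum.swap)
  also have "\<dots> = (\<Sum>i\<in>UNIV. s i * A i / c + s i * B i / c)"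
    by (simp only: sum.distrib sum_divide_distrib[symmetric] sum_distrib_right[symmetric]
        mean_little_kernel sum_little_kernel s_def mult_1_left)
  also have "\<dots> = 1"
    using c by (simp add: add_divide_distrib[symmetric] distrib_left[symmetric]
        sum_divide_distrib[symmetric])
  finally have total: "(\<Sum>x1\<in>UNIV. h x1) = 1" .
  have "(\<integral>\<^sup>+ x1. ennreal (h x1) \<partial>count_space UNIV) = 1"
    using nonneg total by (simp add: nn_integral_count_space_finite sum_ennreal)
  then have "pmf (embed_pmf h) x1 = h x1" for x1
    using nonneg by (intro pmf_embed_pmf)
  then show ?thesis unfolding h_def by blast
qed

lemma linear_local_field: "linear (\<lambda>\<theta>. local_field x \<theta> i)"
  by (rule linearI)
    (simp_all add: local_field_def weight_def bias_def sum.distrib sum_distrib_left distrib_left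
      distrib_right mult.assoc del: sum_mult_of_bool_eq sum_of_bool_mult_eq)

text \<open>The factor \<open>x\<^sub>i - s\<^sub>i\<close> is the logarithmic derivative of the \<open>i\<close>-th Bernoulli factor with
  respect to its field, so every term of the product rule contains the whole kernel.\<close>
lemma has_derivative_little_kernel:
  fixes \<theta> :: "'n::finite param"
  shows "((\<lambda>\<theta>'. little_kernel \<theta>' x0 x1) has_derivative
    (\<lambda>h. little_kernel \<theta> x0 x1 *
      (\<Sum>i\<in>UNIV. (of_bool (x1 $ i) - sigmoid (local_field x0 \<theta> i)) * local_field x0 h i))) (at \<theta>)"
proof -
  define f where "f i \<theta>' = (if x1 $ i then sigmoid (local_field x0 \<theta>' i)
    else 1 - sigmoid (local_field x0 \<theta>' i))" for i \<theta>'
  define d where "d i = (of_bool (x1 $ i) - sigmoid (local_field x0 \<theta> i)) * f i \<theta>" for i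
  have factor: "(f i has_derivative (\<lambda>h. d i * local_field x0 h i)) (at \<theta>)" for i
  proof -
    have u: "((\<lambda>\<theta>'. local_field x0 \<theta>' i) has_derivative (\<lambda>h. local_field x0 h i)) (at \<theta>)"
      by (rule linear_imp_has_derivative) (rule linear_local_field)
    have "((\<lambda>t. if x1 $ i then sigmoid t else 1 - sigmoid t) has_real_derivative d i)
        (at (local_field x0 \<theta> i))"
      by (auto simp: d_def f_def mult.commute
          intro!: has_real_derivative_sigmoid[THEN DERIV_cong] derivative_eq_intros)
    from has_derivative_compose[OF u this[unfolded has_field_derivative_def]]
    show ?thesis by (simp add: f_def[abs_def])
  qed
  have "((\<lambda>\<theta>'. \<Prod>i\<in>UNIV. f i \<theta>') has_derivative
      (\<lambda>h. \<Sum>i\<in>UNIV. d i * local_field x0 h i * (\<Prod>j\<in>UNIV - {i}. f j \<theta>))) (at \<theta>)"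
    by (rule has_derivative_prod) (rule factor)
  moreover have "d i * local_field x0 h i * (\<Prod>j\<in>UNIV - {i}. f j \<theta>) =
      (\<Prod>j\<in>UNIV. f j \<theta>) *
        ((of_bool (x1 $ i) - sigmoid (local_field x0 \<theta> i)) * local_field x0 h i)" for i h
    by (subst prod.remove[of UNIV i]) (auto simp: d_def)
  moreover have "little_kernel \<theta>' x0 x1 = (\<Prod>i\<in>UNIV. f i \<theta>')" for \<theta>'
    by (simp add: little_kernel_eq_prod_if f_def)
  ultimately show ?thesis by (simp add: sum_distrib_left)
qed

lemma has_derivative_imp_gderiv:
  fixes f :: "'a::euclidean_space \<Rightarrow> real"
  assumes "(f has_derivative L) (at x)"
  obtains g where "GDERIV f x :> g" and "\<And>h. g \<bullet> h = L h"
proof -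
  interpret L: linear L using assms by (rule has_derivative_linear)
  define g where "g = (\<Sum>b\<in>Basis. L b *\<^sub>R b)"
  have g: "g \<bullet> h = L h" for h
  proof -
    have "L h = L (\<Sum>b\<in>Basis. (h \<bullet> b) *\<^sub>R b)" by (simp add: euclidean_representation)
    also have "\<dots> = g \<bullet> h"
      by (simp add: L.sum L.scale g_def inner_sum_left mult.commute inner_commute[of h])
    finally show ?thesis by simp
  qed
  have "L = (\<lambda>h. h \<bullet> g)" by (simp add: fun_eq_iff g[symmetric] inner_commute)
  with assms have "GDERIV f x :> g" by (simp add: gderiv_def)
  then show ?thesis using g by (rule that)
qed

theorem mainTheorem3:
  fixes \<theta> v :: "'n::finite param" and x0 :: "'n state"
  assumes "c_const \<theta> v x0 \<noteq> 0"
  shows "(\<exists>p :: 'n state pmf. \<forall>x1. pmf p x1 = P_plus \<theta> v x0 x1)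
    \<and> (\<exists>q :: 'n state pmf. \<forall>x1. pmf q x1 = P_minus \<theta> v x0 x1)
    \<and> (\<forall>e :: 'n state \<Rightarrow> real. \<exists>g :: 'n param.
          GDERIV (\<lambda>\<theta>'. \<Sum>x1\<in>UNIV. e x1 * little_kernel \<theta>' x0 x1) \<theta> :> g
          \<and> g \<bullet> v = c_const \<theta> v x0 *
              ((\<Sum>x1\<in>UNIV. e x1 * P_plus \<theta> v x0 x1) - (\<Sum>x1\<in>UNIV. e x1 * P_minus \<theta> v x0 x1)))"
proof -
  define A where "A i = pos_part (bias v i) +
    (\<Sum>j\<in>UNIV. pos_part (weight v i j) * of_bool (x0 $ j))" for i
  define B where "B i = neg_part (bias v i) +
    (\<Sum>j\<in>UNIV. neg_part (weight v i j) * of_bool (x0 $ j))" for i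
  define s where "s i = sigmoid (local_field x0 \<theta> i)" for i
  define c where "c = c_const \<theta> v x0"
  have nonneg: "0 \<le> A i" "0 \<le> B i" for i
    unfolding A_def B_def pos_part_def neg_part_def
    by (auto intro!: add_nonneg_nonneg sum_nonneg mult_nonneg_nonneg)
  have abs_split: "\<bar>a\<bar> = pos_part a + neg_part a" and diff_split: "a = pos_part a - neg_part a"
    for a by (auto simp: pos_part_def neg_part_def)
  have AB_add: "A i + B i = \<bar>bias v i\<bar> + (\<Sum>j\<in>UNIV. \<bar>weight v i j\<bar> * of_bool (x0 $ j))" for i
    by (simp add: A_def B_def abs_split sum.distrib distrib_right)
  have AB_diff: "local_field x0 v i = A i - B i" for i
    unfolding local_field_def
    by (subst (1) diff_split, subst (2) diff_split)
      (simp add: A_def B_def sum_subtractf left_diff_distrib)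
  have c_eq: "c = (\<Sum>i\<in>UNIV. s i * (A i + B i))"
    by (simp add: c_def c_const_def AB_add s_def sum.distrib distrib_left sum_distrib_left mult_ac)
  have plus: "P_plus \<theta> v x0 x1 = little_kernel \<theta> x0 x1 / c *
      (\<Sum>i\<in>UNIV. of_bool (x1 $ i) * A i + s i * B i)" for x1
    by (simp add: P_plus_def A_def B_def s_def c_def)
  have minus: "P_minus \<theta> v x0 x1 = little_kernel \<theta> x0 x1 / c *
      (\<Sum>i\<in>UNIV. of_bool (x1 $ i) * B i + s i * A i)" for x1
    by (simp add: P_minus_def A_def B_def s_def c_def)
  have "c \<noteq> 0" using assms by (simp add: c_def)
  have "\<exists>p :: 'n state pmf. \<forall>x1. pmf p x1 = P_plus \<theta> v x0 x1"
    unfolding plus s_def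
    using nonneg \<open>c \<noteq> 0\<close> c_eq by (intro tilted_kernel_pmf) (auto simp: s_def)
  moreover have "\<exists>q :: 'n state pmf. \<forall>x1. pmf q x1 = P_minus \<theta> v x0 x1"
    unfolding minus s_def
    using nonneg \<open>c \<noteq> 0\<close> c_eq by (intro tilted_kernel_pmf) (auto simp: s_def add.commute)
  moreover have "\<exists>g :: 'n param.
      GDERIV (\<lambda>\<theta>'. \<Sum>x1\<in>UNIV. e x1 * little_kernel \<theta>' x0 x1) \<theta> :> g
      \<and> g \<bullet> v = c_const \<theta> v x0 *
          ((\<Sum>x1\<in>UNIV. e x1 * P_plus \<theta> v x0 x1) - (\<Sum>x1\<in>UNIV. e x1 * P_minus \<theta> v x0 x1))"
    for e :: "'n state \<Rightarrow> real"
  proof -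
    have "((\<lambda>\<theta>'. \<Sum>x1\<in>UNIV. e x1 * little_kernel \<theta>' x0 x1) has_derivative
        (\<lambda>h. \<Sum>x1\<in>UNIV. e x1 * (little_kernel \<theta> x0 x1 *
          (\<Sum>i\<in>UNIV. (of_bool (x1 $ i) - s i) * local_field x0 h i)))) (at \<theta>)"
      unfolding s_def
      by (intro has_derivative_sum has_derivative_mult_right has_derivative_little_kernel)
    then obtain g where g: "GDERIV (\<lambda>\<theta>'. \<Sum>x1\<in>UNIV. e x1 * little_kernel \<theta>' x0 x1) \<theta> :> g"
      and gv: "g \<bullet> v = (\<Sum>x1\<in>UNIV. e x1 * (little_kernel \<theta> x0 x1 *
          (\<Sum>i\<in>UNIV. (of_bool (x1 $ i) - s i) * local_field x0 v i)))"
      by (rule has_derivative_imp_gderiv) blast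
    have "little_kernel \<theta> x0 x1 * (\<Sum>i\<in>UNIV. (of_bool (x1 $ i) - s i) * local_field x0 v i) =
        c * (P_plus \<theta> v x0 x1 - P_minus \<theta> v x0 x1)" for x1
    proof -
      have "(\<Sum>i\<in>UNIV. (of_bool (x1 $ i) - s i) * local_field x0 v i) =
          (\<Sum>i\<in>UNIV. of_bool (x1 $ i) * A i + s i * B i) -
          (\<Sum>i\<in>UNIV. of_bool (x1 $ i) * B i + s i * A i)"
        unfolding sum_subtractf[symmetric] AB_diff by (intro sum.cong) (auto simp: algebra_simps)
      then show ?thesis
        using \<open>c \<noteq> 0\<close> by (simp add: plus minus right_diff_distrib)
    qed
    then have "g \<bullet> v = (\<Sum>x1\<in>UNIV. e x1 * (c * (P_plus \<theta> v x0 x1 - P_minus \<theta> v x0 x1)))"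
      by (simp only: gv)
    also have "\<dots> = c * ((\<Sum>x1\<in>UNIV. e x1 * P_plus \<theta> v x0 x1) -
        (\<Sum>x1\<in>UNIV. e x1 * P_minus \<theta> v x0 x1))"
      unfolding sum_subtractf[symmetric] sum_distrib_left
      by (intro sum.cong) (auto simp: algebra_simps)
    finally have "g \<bullet> v = c * ((\<Sum>x1\<in>UNIV. e x1 * P_plus \<theta> v x0 x1) -
        (\<Sum>x1\<in>UNIV. e x1 * P_minus \<theta> v x0 x1))" .
    with g show ?thesis unfolding c_def by blast
  qed
  ultimately show ?thesis by blast
qed

end
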